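(* For every bounded derivative property $\mathcal{P}$, there exists a one-sided error $\alpha$-erasure-resilient $\varepsilon$-tester for $\mathcal{P}$ of real-valued functions on the line $[n]$ that works for all $\alpha,\varepsilon\in(0,1)$, with query complexity $O\!\left(\frac{1}{1-\alpha}\cdot\frac{\log n}{\varepsilon}\right)$.
   Context: An $\alpha$-erased function $f:[n]\to\mathbb{R}\cup\{\perp\}$ equals $\perp$ (erased) on at most an $\alpha$ fraction of $[n]$, with nonerased set $\mathcal{N}$; a restoration is a real-valued function agreeing with $f$ on $\mathcal{N}$. An $\alpha$-erasure-resilient $\varepsilon$-tester for $\mathcal{P}$, with query access to $f$ (queries return $f(x)$ or $\perp$; $\mathcal{N}$ unknown), with probability at least $2/3$ accepts if some restoration satisfies $\mathcal{P}$ and rejects if every restoration must be changed on at least an $\varepsilon$ fraction of $\mathcal{N}$ to satisfy $\mathcal{P}$; one-sided error means always accepting in the first case; query complexity is worst case. A bounded derivative property on the line is given by bounding functions $l,u:[n-1]\to\mathbb{R}\cup\{\pm\infty\}$ with $l(t)<u(t)$; a function $f$ on $\mathcal{D}\subseteq[n]$ has it iff for all $x<y$ in $\mathcal{D}$, $\sum_{t=x}^{y-1}l(t)\le f(y)-f(x)\le\sum_{t=x}^{y-1}u(t)$ (e.g., monotonicity: $l=0,u=\infty$; $c$-Lipschitz: $l=-c,u=c$). *)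

theory Defs
  imports "HOL-Probability.Probability"
begin

section \<open>Partially erased functions on the line\<close>

text \<open>
  The line \<open>[n]\<close> is \<open>{1..n}\<close>. A function \<open>f : [n] \<rightarrow> \<real> \<union> {\<bottom>}\<close> is a map \<open>f :: nat \<rightharpoonup> real\<close>
  with \<open>dom f \<subseteq> {1..n}\<close>; the value \<open>None\<close> plays the role of the erasure symbol, so \<open>dom f\<close>
  is the nonerased set.
\<close>

definition erased_function :: "nat \<Rightarrow> real \<Rightarrow> (nat \<rightharpoonup> real) \<Rightarrow> bool" where
  "erased_function n \<alpha> f \<longleftrightarrow>
     dom f \<subseteq> {1..n} \<and> real (card ({1..n} - dom f)) \<le> \<alpha> * real n"

definition restoration :: "(nat \<rightharpoonup> real) \<Rightarrow> (nat \<Rightarrow> real) \<Rightarrow> bool" where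
  "restoration f g \<longleftrightarrow> (\<forall>x\<in>dom f. f x = Some (g x))"

text \<open>
  A property of real-valued functions on \<open>[n]\<close> is a set of total functions on \<open>nat\<close>; the
  properties considered below only depend on the values on \<open>{1..n}\<close>.
\<close>

definition restorable :: "(nat \<Rightarrow> real) set \<Rightarrow> (nat \<rightharpoonup> real) \<Rightarrow> bool" where
  "restorable P f \<longleftrightarrow> (\<exists>g. restoration f g \<and> g \<in> P)"

definition erasure_far :: "(nat \<Rightarrow> real) set \<Rightarrow> real \<Rightarrow> (nat \<rightharpoonup> real) \<Rightarrow> bool" where
  "erasure_far P \<epsilon> f \<longleftrightarrow>
     (\<forall>g. restoration f g \<longrightarrow>
        (\<forall>h\<in>P. \<epsilon> * real (card (dom f)) \<le> real (card {x \<in> dom f. g x \<noteq> h x})))"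


section \<open>Randomized algorithms with query access\<close>

text \<open>
  A randomized adaptive algorithm either stops with a verdict (\<open>True\<close> means accept), queries
  a point and continues depending on the answer, or draws its continuation at random.
\<close>

datatype query_algorithm =
    Verdict bool
  | Query nat "real option \<Rightarrow> query_algorithm"
  | Sample "query_algorithm pmf"

text \<open>The joint distribution of the verdict and the sequence of points queried on input \<open>f\<close>.\<close>

primrec run :: "(nat \<rightharpoonup> real) \<Rightarrow> query_algorithm \<Rightarrow> (bool \<times> nat list) pmf" where
  "run f (Verdict b) = return_pmf (b, [])"
| "run f (Query x k) = map_pmf (\<lambda>(b, qs). (b, x # qs)) (run f (k (f x)))"
| "run f (Sample p) = join_pmf (map_pmf (run f) p)"

definition erasure_resilient_tester ::
    "nat \<Rightarrow> (nat \<Rightarrow> real) set \<Rightarrow> real \<Rightarrow> real \<Rightarrow> query_algorithm \<Rightarrow> bool" where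
  "erasure_resilient_tester n P \<alpha> \<epsilon> T \<longleftrightarrow>
     (\<forall>f. erased_function n \<alpha> f \<longrightarrow>
        (\<forall>(b, qs)\<in>set_pmf (run f T). set qs \<subseteq> {1..n}) \<and>
        (restorable P f \<longrightarrow> measure_pmf.prob (run f T) {(b, qs). b} \<ge> 2 / 3) \<and>
        (erasure_far P \<epsilon> f \<longrightarrow> measure_pmf.prob (run f T) {(b, qs). \<not> b} \<ge> 2 / 3))"

definition one_sided_error ::
    "nat \<Rightarrow> (nat \<Rightarrow> real) set \<Rightarrow> real \<Rightarrow> query_algorithm \<Rightarrow> bool" where
  "one_sided_error n P \<alpha> T \<longleftrightarrow>
     (\<forall>f. erased_function n \<alpha> f \<longrightarrow> restorable P f \<longrightarrow>
        (\<forall>(b, qs)\<in>set_pmf (run f T). b))"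

text \<open>
  Worst-case query complexity at most \<open>q\<close>: the bound holds for every \<open>\<alpha>\<close>-erased input and
  every outcome of the random choices.
\<close>

definition query_complexity_le :: "nat \<Rightarrow> real \<Rightarrow> query_algorithm \<Rightarrow> real \<Rightarrow> bool" where
  "query_complexity_le n \<alpha> T q \<longleftrightarrow>
     (\<forall>f. erased_function n \<alpha> f \<longrightarrow>
        (\<forall>(b, qs)\<in>set_pmf (run f T). real (length qs) \<le> q))"


section \<open>Bounded derivative properties\<close>

text \<open>
  Sums are taken in \<open>ereal\<close>. They never mix the two infinities, because \<open>l t < u t\<close> excludes
  \<open>l t = \<infinity>\<close> and \<open>u t = -\<infinity>\<close>.
\<close>

definition has_bounded_derivative ::
    "(nat \<Rightarrow> ereal) \<Rightarrow> (nat \<Rightarrow> ereal) \<Rightarrow> nat set \<Rightarrow> (nat \<Rightarrow> real) \<Rightarrow> bool" where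
  "has_bounded_derivative l u D f \<longleftrightarrow>
     (\<forall>x\<in>D. \<forall>y\<in>D. x < y \<longrightarrow>
        (\<Sum>t = x..y - 1. l t) \<le> ereal (f y - f x) \<and>
        ereal (f y - f x) \<le> (\<Sum>t = x..y - 1. u t))"

definition bounded_derivative_property :: "nat \<Rightarrow> (nat \<Rightarrow> real) set \<Rightarrow> bool" where
  "bounded_derivative_property n P \<longleftrightarrow>
     (\<exists>l u. (\<forall>t\<in>{1..n - 1}. l t < u t) \<and> P = {f. has_bounded_derivative l u {1..n} f})"

end

theory Submission
  imports Defs
begin

text \<open>
  Draw a uniformly random permutation \<open>\<pi>\<close> of \<open>[n]\<close> and \<open>t\<close> independent uniform points of \<open>[n]\<close>
  with \<open>t\<close> of order \<open>1 / (\<epsilon> (1 - \<alpha>))\<close>. For each drawn nonerased \<open>x\<close>, go through \<open>\<pi>\<close> and query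
  \<open>z\<close> unless a nonerased point between \<open>z\<close> and \<open>x\<close> is already known; reject if \<open>x\<close> and \<open>z\<close>
  violate the property. This is the search for \<open>x\<close> in a random binary search tree on the
  nonerased points.

  For every fixed \<open>\<pi>\<close>, the points whose search finds no violation satisfy the property among
  themselves, and a partial function satisfying the property extends to \<open>[n]\<close>. So if \<open>f\<close> is far
  from the property, at least \<open>\<epsilon> (1 - \<alpha>) n\<close> choices of \<open>x\<close> lead to rejection.

  The search for \<open>x\<close> queries \<open>z\<close> only if \<open>z\<close> comes first in \<open>\<pi>\<close> among itself and the nonerased
  points between \<open>z\<close> and \<open>x\<close>, which has probability one over the number of these points. Summed
  over all nonerased \<open>x\<close> this is at most \<open>2 H\<^sub>n\<close> for each \<open>z\<close>, so a search started at a uniform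
  point of \<open>[n]\<close> makes \<open>O(log n)\<close> queries on average, whatever the erasures. By Markov's
  inequality the algorithm may be cut off, accepting, after a constant times the expected total.
\<close>

section \<open>Deterministic algorithms and truncation\<close>

primrec deterministic :: "query_algorithm \<Rightarrow> bool" where
  "deterministic (Verdict b) \<longleftrightarrow> True"
| "deterministic (Query x k) \<longleftrightarrow> (\<forall>a. deterministic (k a))"
| "deterministic (Sample p) \<longleftrightarrow> False"

text \<open>The value on \<open>Sample\<close> is arbitrary, since \<open>play\<close> is applied
  only to deterministic algorithms. All randomness of the tester is drawn in advance by one
  \<open>Sample\<close> at the root, so everything below it can be studied without
  probability.\<close>

primrec play :: "(nat \<rightharpoonup> real) \<Rightarrow> query_algorithm \<Rightarrow> bool \<times> nat list" where
  "play f (Verdict b) = (b, [])"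
| "play f (Query x k) = (fst (play f (k (f x))), x # snd (play f (k (f x))))"
| "play f (Sample p) = undefined"

text \<open>Running out of budget means acceptance, so truncation never creates a false rejection
  and one-sided error survives.\<close>

primrec truncate_queries :: "query_algorithm \<Rightarrow> nat \<Rightarrow> query_algorithm" where
  "truncate_queries (Verdict b) = (\<lambda>q. Verdict b)"
| "truncate_queries (Query x k) =
     (\<lambda>q. if q = 0 then Verdict True else Query x (\<lambda>a. truncate_queries (k a) (q - 1)))"
| "truncate_queries (Sample p) = (\<lambda>q. Sample (map_pmf (\<lambda>T. truncate_queries T q) p))"

lemma run_deterministic: "deterministic T \<Longrightarrow> run f T = return_pmf (play f T)"
  by (induction T) (auto simp: case_prod_unfold)

lemma deterministic_truncate: "deterministic T \<Longrightarrow> deterministic (truncate_queries T q)"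
  by (induction T arbitrary: q) auto

lemma length_play_truncate:
  "deterministic T \<Longrightarrow> length (snd (play f (truncate_queries T q))) \<le> q"
proof (induction T arbitrary: q)
  case (Query x k)
  then have "length (snd (play f (truncate_queries (k (f x)) (q - 1)))) \<le> q - 1"
    by auto
  then show ?case by (cases q) auto
qed auto

lemma set_play_truncate:
  "deterministic T \<Longrightarrow> set (snd (play f (truncate_queries T q))) \<subseteq> set (snd (play f T))"
proof (induction T arbitrary: q)
  case (Query x k)
  then have "set (snd (play f (truncate_queries (k (f x)) (q - 1)))) \<subseteq> set (snd (play f (k (f x))))"
    by auto
  then show ?case by auto
qed auto

lemma play_truncate_accept:
  "deterministic T \<Longrightarrow> fst (play f T) \<Longrightarrow> fst (play f (truncate_queries T q))"
  by (induction T arbitrary: q) auto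

lemma play_truncate_eq:
  "deterministic T \<Longrightarrow> length (snd (play f T)) \<le> q \<Longrightarrow> play f (truncate_queries T q) = play f T"
proof (induction T arbitrary: q)
  case (Query x k)
  then have "play f (truncate_queries (k (f x)) (q - 1)) = play f (k (f x))"
    by auto
  with Query.prems show ?case by auto
qed auto

section \<open>Searching for a point along a permutation\<close>

definition segment :: "nat \<Rightarrow> nat \<Rightarrow> nat set" where
  "segment x z = {min x z..max x z}"

lemma segment_refl [simp]: "x \<in> segment x z" "z \<in> segment x z"
  by (auto simp: segment_def)

lemma segment_trans: "q \<in> segment x p \<Longrightarrow> p \<in> segment x z \<Longrightarrow> q \<in> segment x z"
  by (auto simp: segment_def)

text \<open>
  With \<open>N\<close> the nonerased set, these \<open>z\<close> are the points queried in the search for \<open>x\<close> along \<open>\<pi>\<close>.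
\<close>

definition visits :: "nat set \<Rightarrow> nat list \<Rightarrow> nat \<Rightarrow> nat \<Rightarrow> bool" where
  "visits N \<pi> x z \<longleftrightarrow> hd (filter (\<lambda>p. p \<in> insert z (N \<inter> segment x z)) \<pi>) = z"

text \<open>Entries after \<open>z\<close> cannot displace it from the head of the filtered list,
  and an earlier entry does so only if it is nonerased and in the segment. This turns a visit into a
  condition on the prefix already processed by the search.\<close>

lemma visits_append_Cons:
  assumes "z \<notin> set ys"
  shows "visits N (ys @ z # zs) x z \<longleftrightarrow> (\<forall>p\<in>set ys \<inter> N. p \<notin> segment x z)"
proof (cases "filter (\<lambda>p. p \<in> insert z (N \<inter> segment x z)) ys")
  case Nil
  then show ?thesis using assms
    by (auto simp: visits_def filter_empty_conv)
next
  case (Cons p ps)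
  then have "p \<in> set (filter (\<lambda>p. p \<in> insert z (N \<inter> segment x z)) ys)"
    by simp
  then show ?thesis using assms Cons by (auto simp: visits_def)
qed

text \<open>An erased \<open>x\<close> starts no search. The initial query of a drawn point, which
  reveals whether it is erased, is not included; later sums add 1 for it.\<close>

definition search_cost :: "nat set \<Rightarrow> nat list \<Rightarrow> nat \<Rightarrow> nat" where
  "search_cost N \<pi> x = (if x \<in> N then length (filter (visits N \<pi> x) \<pi>) else 0)"

section \<open>The test for a fixed permutation and an abstract consistency check\<close>

context
  fixes V :: "nat \<Rightarrow> real \<Rightarrow> nat \<Rightarrow> real \<Rightarrow> bool"
begin

text \<open>\<open>T\<close> is the continuation taken when no violation is found; passing it along
  replaces sequential composition of algorithms. \<open>K\<close> holds the nonerased points found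
  so far. Erased answers are not stored, so they never block later queries. Once \<open>x\<close>
  itself is in \<open>K\<close>, it lies in every segment from \<open>x\<close> and stops all
  further queries.\<close>

primrec search ::
    "nat \<Rightarrow> real \<Rightarrow> query_algorithm \<Rightarrow> nat list \<Rightarrow> nat set \<Rightarrow> query_algorithm" where
  "search x v T [] K = T"
| "search x v T (z # zs) K =
     (if \<exists>p\<in>K. p \<in> segment x z then search x v T zs K
      else Query z (\<lambda>a. case a of
          None \<Rightarrow> search x v T zs K
        | Some w \<Rightarrow> if V x v z w then search x v T zs (insert z K) else Verdict False))"

primrec test_points :: "nat list \<Rightarrow> nat list \<Rightarrow> query_algorithm" where
  "test_points \<pi> [] = Verdict True"
| "test_points \<pi> (x # xs) = Query x (\<lambda>a. case a of
       None \<Rightarrow> test_points \<pi> xs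
     | Some v \<Rightarrow> search x v (test_points \<pi> xs) \<pi> {})"

lemma deterministic_search: "deterministic T \<Longrightarrow> deterministic (search x v T zs K)"
  by (induction zs arbitrary: K) (auto split: option.split)

lemma deterministic_test_points: "deterministic (test_points \<pi> xs)"
  by (induction xs) (auto split: option.split intro: deterministic_search)

lemma set_play_search:
  "set (snd (play f (search x v T zs K))) \<subseteq> set zs \<union> set (snd (play f T))"
proof (induction zs arbitrary: K)
  case (Cons z zs)
  from Cons[of K] Cons[of "insert z K"] show ?case by (auto split: option.split)
qed auto

lemma set_play_test_points:
  "set (snd (play f (test_points \<pi> xs))) \<subseteq> set \<pi> \<union> set xs"
proof (induction xs)
  case (Cons x xs)
  from Cons set_play_search[of f x _ "test_points \<pi> xs" \<pi> "{}"]
  show ?case by (cases "f x") (force, fastforce)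
qed auto

lemma search_accepts:
  assumes "\<And>z w. f z = Some w \<Longrightarrow> V x v z w"
  shows "fst (play f (search x v T zs K)) = fst (play f T)"
  using assms by (induction zs arbitrary: K) (auto split: option.split)

lemma test_points_accept:
  assumes "\<And>x v z w. f x = Some v \<Longrightarrow> f z = Some w \<Longrightarrow> V x v z w"
  shows "fst (play f (test_points \<pi> xs))"
  by (induction xs) (auto split: option.split simp: search_accepts assms)

text \<open>Here \<open>ys\<close> is the prefix already processed. If \<open>z\<close> is visited,
  no nonerased point of \<open>ys\<close> lies in its segment, so no member of \<open>K\<close> can
  block its query, and acceptance forces the check to have succeeded. For this direction
  \<open>K\<close> may be any subset of the nonerased prefix.\<close>

lemma search_accept_imp:
  assumes "fst (play f (search x v T zs K))" "distinct (ys @ zs)" "K \<subseteq> set ys \<inter> dom f"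
  shows "fst (play f T) \<and> (\<forall>z\<in>set zs. \<forall>w. f z = Some w \<longrightarrow> visits (dom f) (ys @ zs) x z \<longrightarrow> V x v z w)"
  using assms
proof (induction zs arbitrary: ys K)
  case (Cons z zs)
  have visit: "visits (dom f) (ys @ z # zs) x z \<longleftrightarrow> (\<forall>p\<in>set ys \<inter> dom f. p \<notin> segment x z)"
    using Cons.prems by (intro visits_append_Cons) auto
  have IH: "fst (play f T) \<and> (\<forall>z\<in>set zs. \<forall>w. f z = Some w \<longrightarrow>
      visits (dom f) (ys @ z' # zs) x z \<longrightarrow> V x v z w)"
    if "fst (play f (search x v T zs K'))" "K' \<subseteq> set (ys @ [z]) \<inter> dom f" "z' = z" for K' z'
    using Cons.IH[OF that(1) _ that(2)] Cons.prems that(3) by auto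
  show ?case
  proof (cases "\<exists>p\<in>K. p \<in> segment x z")
    case True
    then have "\<not> visits (dom f) (ys @ z # zs) x z"
      using visit Cons.prems by auto
    then show ?thesis using IH[of K z] True Cons.prems by auto
  next
    case False
    show ?thesis
    proof (cases "f z")
      case None
      then show ?thesis using IH[of K z] False Cons.prems by auto
    next
      case (Some w)
      then show ?thesis using IH[of "insert z K" z] False Cons.prems
        by (auto split: if_splits)
    qed
  qed
qed auto

lemma test_points_accept_imp:
  assumes "fst (play f (test_points \<pi> xs))" "distinct \<pi>"
    and "x \<in> set xs" "f x = Some v" "z \<in> set \<pi>" "f z = Some w" "visits (dom f) \<pi> x z"
  shows "V x v z w"
  using assms
proof (induction xs)
  case (Cons y ys)
  show ?case
  proof (cases "f y")
    case None
    then show ?thesis using Cons by auto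
  next
    case (Some v')
    with Cons.prems have "fst (play f (search y v' (test_points \<pi> ys) \<pi> {}))"
      by simp
    from search_accept_imp[OF this, of "[]"] Cons Some show ?thesis
      by auto
  qed
qed auto

text \<open>The converse direction needs \<open>K\<close> to be rich enough. It cannot contain every
  nonerased point of \<open>ys\<close>, since blocked points were never queried, but each such point
  has a member of \<open>K\<close> on its segment. By transitivity of segments, a \<open>z\<close>
  not blocked by \<open>K\<close> is not blocked by any nonerased point of \<open>ys\<close>, so
  every query is a visit.\<close>

lemma length_play_search:
  assumes "distinct (ys @ zs)" "\<And>p. p \<in> set ys \<inter> dom f \<Longrightarrow> \<exists>q\<in>K. q \<in> segment x p"
  shows "length (snd (play f (search x v T zs K)))
           \<le> length (filter (visits (dom f) (ys @ zs) x) zs) + length (snd (play f T))"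
  using assms
proof (induction zs arbitrary: ys K)
  case (Cons z zs)
  have visit: "visits (dom f) (ys @ z # zs) x z \<longleftrightarrow> (\<forall>p\<in>set ys \<inter> dom f. p \<notin> segment x z)"
    using Cons.prems by (intro visits_append_Cons) auto
  have IH: "length (snd (play f (search x v T zs K')))
      \<le> length (filter (visits (dom f) (ys @ z # zs) x) zs) + length (snd (play f T))"
    if "\<And>p. p \<in> set (ys @ [z]) \<inter> dom f \<Longrightarrow> \<exists>q\<in>K'. q \<in> segment x p" for K'
    using Cons.IH[of "ys @ [z]" K'] that Cons.prems(1) by simp
  show ?case
  proof (cases "\<exists>p\<in>K. p \<in> segment x z")
    case True
    then have "length (snd (play f (search x v T (z # zs) K)))
        \<le> length (filter (visits (dom f) (ys @ z # zs) x) zs) + length (snd (play f T))"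
      using IH[of K] Cons.prems(2) by auto
    also have "\<dots> \<le> length (filter (visits (dom f) (ys @ z # zs) x) (z # zs)) + length (snd (play f T))"
      by simp
    finally show ?thesis .
  next
    case False
    then have "visits (dom f) (ys @ z # zs) x z"
      using visit Cons.prems(2) segment_trans by blast
    moreover have "length (snd (play f (search x v T zs K)))
        \<le> length (filter (visits (dom f) (ys @ z # zs) x) zs) + length (snd (play f T))"
      if "f z = None" using IH[of K] Cons.prems(2) that by auto
    moreover have "length (snd (play f (search x v T zs (insert z K))))
        \<le> length (filter (visits (dom f) (ys @ z # zs) x) zs) + length (snd (play f T))"
      using Cons.prems(2) by (intro IH) auto
    ultimately show ?thesis using False by (auto split: option.split)
  qed
qed auto

lemma length_play_test_points:
  assumes "distinct \<pi>"
  shows "length (snd (play f (test_points \<pi> xs))) \<le> (\<Sum>x\<leftarrow>xs. 1 + search_cost (dom f) \<pi> x)"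
proof (induction xs)
  case (Cons x xs)
  show ?case
  proof (cases "f x")
    case (Some v)
    then show ?thesis
      using length_play_search[of "[]" \<pi> f "{}" x v "test_points \<pi> xs"] assms Cons
      by (auto simp: search_cost_def)
  qed (use Cons in auto)
qed auto

end

section \<open>The expected cost of a search\<close>

lemma hd_filter_subset:
  assumes "hd (filter (\<lambda>p. p \<in> S) \<pi>) = a" "a \<in> S'" "S' \<subseteq> S" "a \<in> set \<pi>"
  shows "hd (filter (\<lambda>p. p \<in> S') \<pi>) = a"
  using assms by (induction \<pi>) (auto split: if_splits)

lemma hd_filter_mem:
  assumes "S \<inter> set \<pi> \<noteq> {}"
  shows "hd (filter (\<lambda>p. p \<in> S) \<pi>) \<in> S \<inter> set \<pi>"
proof -
  have "filter (\<lambda>p. p \<in> S) \<pi> \<noteq> []"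
    using assms by (auto simp: filter_empty_conv)
  from hd_in_set[OF this] show ?thesis by auto
qed

text \<open>Symmetry: swapping the entries \<open>b\<close> and \<open>c\<close> of \<open>S\<close>
  preserves membership in \<open>S\<close>, hence maps the permutations in which \<open>b\<close>
  comes first among \<open>S\<close> injectively to those in which \<open>c\<close> does. These
  classes partition all permutations and therefore have equal size.\<close>

lemma card_permutations_hd_filter:
  assumes "finite A" "S \<subseteq> A" "a \<in> S"
  shows "card {\<pi>\<in>permutations_of_set A. hd (filter (\<lambda>p. p \<in> S) \<pi>) = a} * card S = fact (card A)"
proof -
  define F where "F b = {\<pi>\<in>permutations_of_set A. hd (filter (\<lambda>p. p \<in> S) \<pi>) = b}" for b
  have fin: "finite (F b)" for b
    unfolding F_def by simp
  have le: "card (F b) \<le> card (F c)" if "b \<in> S" "c \<in> S" for b c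
  proof (rule card_inj_on_le)
    show "inj_on (map (Transposition.transpose b c)) (F b)"
      by (rule inj_on_subset[OF inj_mapI]) auto
    show "map (Transposition.transpose b c) ` F b \<subseteq> F c"
    proof
      fix \<pi>' assume "\<pi>' \<in> map (Transposition.transpose b c) ` F b"
      then obtain \<pi> where \<pi>: "\<pi> \<in> F b" "\<pi>' = map (Transposition.transpose b c) \<pi>" by auto
      have "Transposition.transpose b c p \<in> S \<longleftrightarrow> p \<in> S" for p
        using that by (auto simp: Transposition.transpose_def)
      then have "filter (\<lambda>p. p \<in> S) \<pi>' = map (Transposition.transpose b c) (filter (\<lambda>p. p \<in> S) \<pi>)"
        using \<pi> by (simp add: filter_map o_def)
      moreover have "filter (\<lambda>p. p \<in> S) \<pi> \<noteq> []"
        using \<pi> that assms by (auto simp: F_def permutations_of_set_def filter_empty_conv)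
      moreover have "Transposition.transpose b c ` A = A"
        using that assms by (intro Transposition.transpose_image_eq) auto
      ultimately show "\<pi>' \<in> F c"
        using \<pi> by (auto simp: F_def permutations_of_set_def hd_map distinct_map)
    qed
  qed (rule fin)
  have "permutations_of_set A = (\<Union>b\<in>S. F b)"
  proof -
    have "hd (filter (\<lambda>p. p \<in> S) \<pi>) \<in> S" if "\<pi> \<in> permutations_of_set A" for \<pi>
      using hd_filter_mem[of S \<pi>] that assms by (auto simp: permutations_of_set_def)
    then show ?thesis by (auto simp: F_def)
  qed
  then have "fact (card A) = card (\<Union>b\<in>S. F b)"
    using assms by (simp flip: card_permutations_of_set)
  also have "\<dots> = (\<Sum>b\<in>S. card (F b))"
    using assms fin by (intro card_UN_disjoint) (auto simp: F_def intro: finite_subset)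
  also have "\<dots> = (\<Sum>b\<in>S. card (F a))"
    using le assms by (intro sum.cong) (auto intro: le_antisym)
  finally show ?thesis by (simp add: F_def mult.commute)
qed

section \<open>Harmonic bounds on the average search cost\<close>

lemma sum_inverse_inj_le_harm:
  fixes r :: "'a \<Rightarrow> nat"
  assumes "inj_on r B" "r ` B \<subseteq> {1..n}"
  shows "(\<Sum>x\<in>B. 1 / real (r x)) \<le> harm n"
proof -
  have "(\<Sum>x\<in>B. 1 / real (r x)) = (\<Sum>k\<in>r ` B. 1 / real k)"
    using assms by (simp add: sum.reindex)
  also have "\<dots> \<le> (\<Sum>k=1..n. 1 / real k)"
    using assms by (intro sum_mono2) auto
  finally show ?thesis by (simp add: harm_def divide_inverse)
qed

text \<open>On either side of \<open>z\<close>, the number of nonerased points in the segment is the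
  rank of \<open>x\<close> by distance from \<open>z\<close>. Ranks on one side are distinct, so
  each side contributes at most a harmonic number. Inserting \<open>z\<close> only enlarges the
  denominators.\<close>

lemma sum_inverse_card_segment:
  assumes "N \<subseteq> {1..n}"
  shows "(\<Sum>x\<in>N. 1 / real (card (insert z (N \<inter> segment x z)))) \<le> 2 * harm n"
proof -
  have finN: "finite N" using assms finite_subset by blast
  define r where "r x = card (N \<inter> segment x z)" for x
  have fin: "finite (N \<inter> segment x z)" for x using finN by simp
  have range: "r x \<in> {1..n}" if "x \<in> N" for x
  proof -
    have "r x \<le> card {1..n}" unfolding r_def using assms by (intro card_mono) auto
    moreover have "r x \<noteq> 0" using that fin[of x] unfolding r_def by (auto simp: card_eq_0_iff)
    ultimately show ?thesis by auto
  qed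
  have mono: "r x < r y" if "x \<in> segment y z" "x \<noteq> y" "y \<in> N" for x y
    unfolding r_def
  proof (rule psubset_card_mono[OF fin])
    have "y \<in> N \<inter> segment y z" "y \<notin> N \<inter> segment x z"
      using that by (auto simp: segment_def)
    moreover have "N \<inter> segment x z \<subseteq> N \<inter> segment y z"
      using that by (auto simp: segment_def)
    ultimately show "N \<inter> segment x z \<subset> N \<inter> segment y z" by blast
  qed
  have inj: "inj_on r B"
    if "B \<subseteq> N" "\<And>x y. x \<in> B \<Longrightarrow> y \<in> B \<Longrightarrow> x \<in> segment y z \<or> y \<in> segment x z" for B
  proof (rule inj_onI, rule ccontr)
    fix x y assume "x \<in> B" "y \<in> B" "r x = r y" "x \<noteq> y"
    then show False using that mono[of x y] mono[of y x] by auto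
  qed
  have "(\<Sum>x\<in>N. 1 / real (card (insert z (N \<inter> segment x z)))) \<le> (\<Sum>x\<in>N. 1 / real (r x))"
  proof (intro sum_mono divide_left_mono)
    fix x assume "x \<in> N"
    show "real (r x) \<le> real (card (insert z (N \<inter> segment x z)))"
      using fin unfolding r_def by (simp add: card_insert_le)
    show "0 < real (card (insert z (N \<inter> segment x z))) * real (r x)"
      using range[OF \<open>x \<in> N\<close>] fin[of x] by (simp add: card_gt_0_iff)
  qed auto
  also have "\<dots> = (\<Sum>x\<in>{x\<in>N. z \<le> x}. 1 / real (r x)) + (\<Sum>x\<in>{x\<in>N. x < z}. 1 / real (r x))"
    using finN by (subst sum.union_disjoint[symmetric]) (auto intro!: sum.cong)
  also have "\<dots> \<le> harm n + harm n"
    by (intro add_mono sum_inverse_inj_le_harm inj) (use range in \<open>auto simp: segment_def\<close>)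
  finally show ?thesis by simp
qed

text \<open>For a single \<open>x\<close> next to a long erased stretch the expected cost can be
  linear, as each erased \<open>z\<close> there is visited with constant probability. Only the sum
  over \<open>x\<close> is controlled: with \<open>z\<close> moved outermost, the visit
  probabilities add up to at most \<open>2 * harm n\<close>.\<close>

lemma sum_search_cost:
  assumes "N \<subseteq> {1..n}"
  shows "(\<Sum>\<pi>\<in>permutations_of_set {1..n}. \<Sum>x=1..n. real (search_cost N \<pi> x))
           \<le> fact n * (2 * harm n) * real n"
proof -
  have finN: "finite N" using assms finite_subset by blast
  define S where "S x z = insert z (N \<inter> segment x z)" for x z
  have cost: "real (search_cost N \<pi> x) = (\<Sum>z=1..n. if visits N \<pi> x z then 1 else 0)"
    if "\<pi> \<in> permutations_of_set {1..n}" "x \<in> N" for \<pi> x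
  proof -
    have "length (filter (visits N \<pi> x) \<pi>) = card ({1..n} \<inter> {z. visits N \<pi> x z})"
      using that by (simp add: permutations_of_set_def distinct_length_filter Int_commute)
    then show ?thesis
      using that by (simp add: search_cost_def sum.If_cases)
  qed
  have perm: "(\<Sum>\<pi>\<in>permutations_of_set {1..n}. if visits N \<pi> x z then 1 else 0)
                = fact n * (1 / real (card (S x z)))" if "z \<in> {1..n}" for x z
  proof -
    have "card {\<pi>\<in>permutations_of_set {1..n}. visits N \<pi> x z} * card (S x z) = fact n"
      unfolding visits_def S_def using that assms
      by (subst card_permutations_hd_filter) auto
    then have "real (card {\<pi>\<in>permutations_of_set {1..n}. visits N \<pi> x z}) * real (card (S x z)) = fact n"
      by (metis of_nat_fact of_nat_mult)
    moreover have "card (S x z) \<noteq> 0"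
      using finN by (simp add: S_def)
    ultimately show ?thesis
      by (simp add: sum.If_cases field_simps Collect_conj_eq[symmetric] Int_def)
  qed
  have "(\<Sum>\<pi>\<in>permutations_of_set {1..n}. \<Sum>x=1..n. real (search_cost N \<pi> x))
      = (\<Sum>\<pi>\<in>permutations_of_set {1..n}. \<Sum>x\<in>N. \<Sum>z=1..n. if visits N \<pi> x z then 1 else 0)"
  proof (rule sum.cong[OF refl])
    fix \<pi> assume "\<pi> \<in> permutations_of_set {1..n}"
    then have "(\<Sum>x\<in>N. real (search_cost N \<pi> x)) = (\<Sum>x\<in>N. \<Sum>z=1..n. if visits N \<pi> x z then 1 else 0)"
      by (intro sum.cong refl cost)
    moreover have "(\<Sum>x=1..n. real (search_cost N \<pi> x)) = (\<Sum>x\<in>N. real (search_cost N \<pi> x))"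
      using assms by (intro sum.mono_neutral_right) (auto simp: search_cost_def)
    ultimately show "(\<Sum>x=1..n. real (search_cost N \<pi> x))
        = (\<Sum>x\<in>N. \<Sum>z=1..n. if visits N \<pi> x z then 1 else 0)" by simp
  qed
  also have "\<dots> = (\<Sum>z=1..n. \<Sum>x\<in>N. \<Sum>\<pi>\<in>permutations_of_set {1..n}. if visits N \<pi> x z then 1 else 0)"
    by (simp only: sum.swap[where A = "permutations_of_set {1..n}"] sum.swap[where A = N and B = "{1..n}"])
  also have "\<dots> = (\<Sum>z=1..n. fact n * (\<Sum>x\<in>N. 1 / real (card (S x z))))"
    unfolding sum_distrib_left by (intro sum.cong refl perm)
  also have "\<dots> \<le> (\<Sum>z=1..n. fact n * (2 * harm n))"
    unfolding S_def by (intro sum_mono mult_left_mono sum_inverse_card_segment assms) auto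
  finally show ?thesis by (simp add: mult_ac)
qed

section \<open>Bounded derivative properties\<close>

text \<open>Half-open ranges make sums over adjacent intervals concatenate.\<close>

lemma has_bounded_derivative_pair:
  assumes "x < y"
  shows "has_bounded_derivative l u {x, y} g \<longleftrightarrow>
    (\<Sum>t\<in>{x..<y}. l t) \<le> ereal (g y - g x) \<and> ereal (g y - g x) \<le> (\<Sum>t\<in>{x..<y}. u t)"
proof -
  have "{x..y - 1} = {x..<y}" using assms by auto
  then show ?thesis using assms by (auto simp: has_bounded_derivative_def)
qed

lemma has_bounded_derivative_iff_pairs:
  "has_bounded_derivative l u D g \<longleftrightarrow> (\<forall>x\<in>D. \<forall>y\<in>D. x < y \<longrightarrow> has_bounded_derivative l u {x, y} g)"
  by (auto simp: has_bounded_derivative_def)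

lemma has_bounded_derivative_trans:
  assumes "has_bounded_derivative l u {x, y} g" "has_bounded_derivative l u {y, z} g" "x \<le> y" "y \<le> z"
  shows "has_bounded_derivative l u {x, z} g"
proof (cases "x = y \<or> y = z")
  case False
  then have less: "x < y" "y < z" using assms by auto
  have split: "sum h {x..<z} = sum h {x..<y} + sum h {y..<z}" for h :: "nat \<Rightarrow> ereal"
    using assms by (simp add: sum.atLeastLessThan_concat)
  have "ereal (g z - g x) = ereal (g y - g x) + ereal (g z - g y)" by simp
  moreover have "x < z" using less by simp
  ultimately show ?thesis
    using assms less by (simp only: has_bounded_derivative_pair split) (metis add_mono)
qed (use assms in auto)

section \<open>Extending functions with bounded derivative\<close>

lemma real_between_ereal:
  assumes "finite A" "finite B" "\<And>a b. a \<in> A \<Longrightarrow> b \<in> B \<Longrightarrow> a \<le> b"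
    and "\<infinity> \<notin> A" "- \<infinity> \<notin> B"
  obtains v :: real where "\<And>a. a \<in> A \<Longrightarrow> a \<le> ereal v" "\<And>b. b \<in> B \<Longrightarrow> ereal v \<le> b"
proof -
  \<comment> \<open>The inserted infinities cover empty \<open>A\<close> or \<open>B\<close>.
    Excluding \<open>lo = \<infinity>\<close> and \<open>hi = -\<infinity>\<close> is what leaves
    room for a real number.\<close>
  define lo where "lo = Max (insert (-\<infinity>) A)"
  define hi where "hi = Min (insert \<infinity> B)"
  have lo: "lo \<in> insert (-\<infinity>) A" "\<And>a. a \<in> A \<Longrightarrow> a \<le> lo"
    unfolding lo_def using assms(1) by (intro Max_in, auto)
  have hi: "hi \<in> insert \<infinity> B" "\<And>b. b \<in> B \<Longrightarrow> hi \<le> b"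
    unfolding hi_def using assms(2) by (intro Min_in, auto)
  have "lo \<le> hi" "lo \<noteq> \<infinity>" "hi \<noteq> -\<infinity>"
    using lo(1) hi(1) assms(3-5) by auto
  then have "\<exists>v. lo \<le> ereal v \<and> ereal v \<le> hi"
    by (cases lo; cases hi) auto
  then show ?thesis using that lo(2) hi(2) order_trans by metis
qed

text \<open>Each point of \<open>D\<close> confines the value at \<open>y\<close> to an interval.
  Every lower end lies below every upper end, so a common value exists. The strict inequalities
  between \<open>l\<close> and \<open>u\<close> keep lower sums from being
  \<open>\<infinity>\<close> and upper sums from being \<open>-\<infinity>\<close>.\<close>

lemma has_bounded_derivative_extend_insert:
  assumes lu: "\<And>t. t \<in> {1..n - 1} \<Longrightarrow> l t < u t" and D: "D \<subseteq> {1..n}" and y: "y \<in> {1..n}" "y \<notin> D"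
    and g: "has_bounded_derivative l u D g"
  obtains v where "has_bounded_derivative l u (insert y D) (g(y := v))"
proof -
  define L where "L a b = (\<Sum>t\<in>{a..<b}. l t)" for a b
  define U where "U a b = (\<Sum>t\<in>{a..<b}. u t)" for a b
  have finD: "finite D" using D finite_subset by blast
  have L_ne: "L a b \<noteq> \<infinity>" and U_ne: "U a b \<noteq> -\<infinity>" and LU: "L a b \<le> U a b"
    if "1 \<le> a" "b \<le> n" for a b
  proof -
    have *: "l t < u t" if "t \<in> {a..<b}" for t
      using lu[of t] that \<open>1 \<le> a\<close> \<open>b \<le> n\<close> by auto
    have fin: "sum h S \<noteq> \<infinity>" if "finite S" "\<And>t. t \<in> S \<Longrightarrow> h t \<noteq> \<infinity>" for h :: "nat \<Rightarrow> ereal" and S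
      using that by (induction S rule: finite_induct) auto
    have fin': "sum h S \<noteq> -\<infinity>" if "finite S" "\<And>t. t \<in> S \<Longrightarrow> h t \<noteq> -\<infinity>" for h :: "nat \<Rightarrow> ereal" and S
      using that by (induction S rule: finite_induct) auto
    show "L a b \<noteq> \<infinity>"
      unfolding L_def using * by (intro fin) force+
    show "U a b \<noteq> -\<infinity>"
      unfolding U_def using * by (intro fin') force+
    show "L a b \<le> U a b"
      unfolding L_def U_def using * by (intro sum_mono less_imp_le)
  qed
  have split: "L a c = L a b + L b c" "U a c = U a b + U b c" if "a \<le> b" "b \<le> c" for a b c
    using that by (simp_all add: L_def U_def sum.atLeastLessThan_concat)
  have gD: "L a b \<le> ereal (g b - g a)" "ereal (g b - g a) \<le> U a b" if "a \<in> D" "b \<in> D" "a < b" for a b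
    using g that has_bounded_derivative_pair[OF \<open>a < b\<close>, of l u g]
    by (auto simp: has_bounded_derivative_iff_pairs[of l u D] L_def U_def)
  \<comment> \<open>\<open>A\<close> collects the lower and \<open>B\<close> the upper bounds on the
    value at \<open>y\<close>. A point to the right of \<open>y\<close> bounds it from below through
    \<open>U\<close> and from above through \<open>L\<close>.\<close>
  define A where "A = (\<lambda>x. ereal (g x) + L x y) ` {x\<in>D. x < y} \<union> (\<lambda>x. ereal (g x) - U y x) ` {x\<in>D. y < x}"
  define B where "B = (\<lambda>x. ereal (g x) + U x y) ` {x\<in>D. x < y} \<union> (\<lambda>x. ereal (g x) - L y x) ` {x\<in>D. y < x}"
  have range: "1 \<le> x" "x \<le> n" if "x \<in> D" for x using D that by auto
  \<comment> \<open>For two points on the same side of \<open>y\<close>, the bound on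
    \<open>g\<close> between them is combined with \<open>L \<le> U\<close> between \<open>y\<close>
    and the nearer one. For points on opposite sides, the bound on \<open>g\<close> across
    \<open>y\<close> is split at \<open>y\<close>.\<close>
  have ll: "ereal (g x) + L x y \<le> ereal (g x') + U x' y" if "x \<in> D" "x' \<in> D" "x < y" "x' < y" for x x'
  proof (cases x x' rule: linorder_cases)
    case less
    have "ereal (g x) + L x y = (ereal (g x) + L x x') + L x' y"
      using less that split(1)[of x x' y] by (simp add: add.assoc)
    also have "\<dots> \<le> (ereal (g x) + ereal (g x' - g x)) + U x' y"
      using that less gD(1)[of x x'] LU[of x' y] range[of x'] y by (intro add_mono) auto
    finally show ?thesis by simp
  next
    case greater
    have "ereal (g x) + L x y \<le> (ereal (g x') + ereal (g x - g x')) + U x y"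
      using that LU[of x y] range[of x] y by (intro add_mono) auto
    also have "\<dots> \<le> (ereal (g x') + U x' x) + U x y"
      using that greater gD(2)[of x' x] by (intro add_mono) auto
    also have "\<dots> = ereal (g x') + U x' y"
      using greater that split(2)[of x' x y] by (simp add: add.assoc)
    finally show ?thesis .
  next
    case equal
    then show ?thesis using LU[of x y] range[of x] that y by (auto intro: add_mono)
  qed
  have rr: "ereal (g x) - U y x \<le> ereal (g x') - L y x'" if "x \<in> D" "x' \<in> D" "y < x" "y < x'" for x x'
  proof (cases x x' rule: linorder_cases)
    case less
    have "L y x \<noteq> \<infinity>" "L x x' \<noteq> \<infinity>" "L y x \<le> U y x" "L x x' \<le> ereal (g x' - g x)"
      using L_ne[of y x] L_ne[of x x'] LU[of y x] gD(1)[of x x'] range that y less by auto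
    then have "ereal (g x) - U y x \<le> ereal (g x') - (L y x + L x x')"
      by (cases "L y x"; cases "L x x'"; cases "U y x") auto
    then show ?thesis using split(1)[of y x x'] that less by simp
  next
    case greater
    have "U y x' \<noteq> -\<infinity>" "U x' x \<noteq> -\<infinity>" "L y x' \<le> U y x'" "ereal (g x - g x') \<le> U x' x"
      using U_ne[of y x'] U_ne[of x' x] LU[of y x'] gD(2)[of x' x] range that y greater by auto
    then have "ereal (g x) - (U y x' + U x' x) \<le> ereal (g x') - L y x'"
      by (cases "U y x'"; cases "U x' x"; cases "L y x'") auto
    then show ?thesis using split(2)[of y x' x] that greater by simp
  next
    case equal
    then show ?thesis using LU[of y x] range[of x] that y by (auto intro: ereal_minus_mono)
  qed
  have lr: "ereal (g x) + L x y \<le> ereal (g x') - L y x'" "ereal (g x') - U y x' \<le> ereal (g x) + U x y"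
    if "x \<in> D" "x' \<in> D" "x < y" "y < x'" for x x'
  proof -
    have "L x y + L y x' \<le> ereal (g x' - g x)"
      using gD(1)[of x x'] split(1)[of x y x'] that by simp
    moreover have "L x y \<noteq> \<infinity>" "L y x' \<noteq> \<infinity>"
      using L_ne range that(1,2) y by auto
    ultimately show "ereal (g x) + L x y \<le> ereal (g x') - L y x'"
      by (cases "L x y"; cases "L y x'") auto
    have "ereal (g x' - g x) \<le> U x y + U y x'"
      using gD(2)[of x x'] split(2)[of x y x'] that by simp
    moreover have "U x y \<noteq> -\<infinity>" "U y x' \<noteq> -\<infinity>"
      using U_ne range that(1,2) y by auto
    ultimately show "ereal (g x') - U y x' \<le> ereal (g x) + U x y"
      by (cases "U x y"; cases "U y x'") auto
  qed
  have "a \<le> b" if "a \<in> A" "b \<in> B" for a b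
    using that ll rr lr unfolding A_def B_def by auto
  moreover have "\<infinity> \<notin> A"
  proof -
    have "\<infinity> \<noteq> ereal (g x) - U y x" "L x' y \<noteq> \<infinity>" if "x \<in> D" "x' \<in> D" for x x'
      using U_ne[of y x] L_ne[of x' y] range that y by (cases "U y x"; auto)+
    then show ?thesis by (auto simp: A_def)
  qed
  moreover have "- \<infinity> \<notin> B"
  proof -
    have "ereal (g x) - L y x \<noteq> - \<infinity>" "U x' y \<noteq> - \<infinity>" if "x \<in> D" "x' \<in> D" for x x'
      using L_ne[of y x] U_ne[of x' y] range that y by (cases "L y x"; auto)+
    then show ?thesis by (fastforce simp: B_def)
  qed
  moreover have "finite A" "finite B" using finD by (simp_all add: A_def B_def)
  ultimately obtain v where v: "\<And>a. a \<in> A \<Longrightarrow> a \<le> ereal v" "\<And>b. b \<in> B \<Longrightarrow> ereal v \<le> b"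
    using real_between_ereal[of A B] by metis
  have left: "L x y \<le> ereal (v - g x)" "ereal (v - g x) \<le> U x y" if "x \<in> D" "x < y" for x
  proof -
    have "ereal (g x) + L x y \<le> ereal v" "ereal v \<le> ereal (g x) + U x y"
      using that by (auto intro!: v simp: A_def B_def)
    then show "L x y \<le> ereal (v - g x)" "ereal (v - g x) \<le> U x y"
      by (cases "L x y"; cases "U x y"; auto)+
  qed
  have right: "L y x \<le> ereal (g x - v)" "ereal (g x - v) \<le> U y x" if "x \<in> D" "y < x" for x
  proof -
    have "ereal (g x) - U y x \<le> ereal v" "ereal v \<le> ereal (g x) - L y x"
      using that by (auto intro!: v simp: A_def B_def)
    then show "L y x \<le> ereal (g x - v)" "ereal (g x - v) \<le> U y x"
      by (cases "L y x"; cases "U y x"; auto)+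
  qed
  have "has_bounded_derivative l u (insert y D) (g(y := v))"
    unfolding has_bounded_derivative_iff_pairs[of l u "insert y D"]
  proof (intro ballI impI)
    fix a b assume "a \<in> insert y D" "b \<in> insert y D" "a < b"
    then show "has_bounded_derivative l u {a, b} (g(y := v))"
      using left[of a] right[of b] gD[of a b] y
      by (subst has_bounded_derivative_pair) (auto simp flip: L_def U_def)
  qed
  then show ?thesis by (rule that)
qed

lemma has_bounded_derivative_extend:
  assumes lu: "\<And>t. t \<in> {1..n - 1} \<Longrightarrow> l t < u t" and D: "D \<subseteq> {1..n}"
    and g: "has_bounded_derivative l u D g"
  obtains h where "has_bounded_derivative l u {1..n} h" "\<And>x. x \<in> D \<Longrightarrow> h x = g x"
proof -
  have "\<exists>h. has_bounded_derivative l u (D \<union> E) h \<and> (\<forall>x\<in>D. h x = g x)" if "E \<subseteq> {1..n}" for E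
  proof -
    have "finite E" using that finite_subset by blast
    then show ?thesis using that
    proof (induction E)
      case empty
      then show ?case using g by auto
    next
      case (insert y E)
      then obtain h where h: "has_bounded_derivative l u (D \<union> E) h" "\<forall>x\<in>D. h x = g x"
        by auto
      show ?case
      proof (cases "y \<in> D \<union> E")
        case True
        then show ?thesis using h by (intro exI[of _ h]) (auto simp: insert_absorb)
      next
        case False
        have "D \<union> E \<subseteq> {1..n}" "y \<in> {1..n}"
          using insert.prems D by auto
        with lu h(1) False obtain v where
          "has_bounded_derivative l u (insert y (D \<union> E)) (h(y := v))"
          using has_bounded_derivative_extend_insert[of n l u "D \<union> E" y h] by blast
        then have "has_bounded_derivative l u (D \<union> insert y E) (h(y := v))" by simp
        moreover have "\<forall>x\<in>D. (h(y := v)) x = g x" using h(2) False by auto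
        ultimately show ?thesis by blast
      qed
    qed
  qed
  from this[of "{1..n}"] obtain h where
    "has_bounded_derivative l u (D \<union> {1..n}) h" "\<forall>x\<in>D. h x = g x" by auto
  then show ?thesis using D that by (auto simp: Un_absorb1)
qed

lemma has_bounded_derivative_cong:
  "(\<And>x. x \<in> D \<Longrightarrow> g x = h x) \<Longrightarrow> has_bounded_derivative l u D g = has_bounded_derivative l u D h"
  by (auto simp: has_bounded_derivative_def)

text \<open>
  Two nonerased points \<open>i < j\<close> whose searches detect no violation both visit the first
  nonerased point of \<open>{i..j}\<close> in the permutation, so the pair \<open>i, j\<close> is not violated.
\<close>

lemma has_bounded_derivative_visited:
  assumes "N \<subseteq> set \<pi>"
    and D: "D = {x\<in>N. \<forall>z\<in>N. visits N \<pi> x z \<longrightarrow> has_bounded_derivative l u {x, z} g}"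
  shows "has_bounded_derivative l u D g"
  unfolding has_bounded_derivative_iff_pairs[of l u D]
proof (intro ballI impI)
  fix i j assume ij: "i \<in> D" "j \<in> D" "i < j"
  define S where "S = N \<inter> {i..j}"
  define p where "p = hd (filter (\<lambda>p. p \<in> S) \<pi>)"
  have "i \<in> S \<inter> set \<pi>" using ij assms by (auto simp: S_def D)
  then have p: "p \<in> S" "p \<in> set \<pi>"
    unfolding p_def using hd_filter_mem[of S \<pi>] by auto
  have "visits N \<pi> i p" "visits N \<pi> j p"
    unfolding visits_def using p ij(3)
    by (intro hd_filter_subset[OF p_def[symmetric]]; auto simp: S_def segment_def)+
  then have "has_bounded_derivative l u {i, p} g" "has_bounded_derivative l u {p, j} g"
    using ij p by (auto simp: D S_def insert_commute)
  then show "has_bounded_derivative l u {i, j} g"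
    using p by (intro has_bounded_derivative_trans[of l u i p g j]) (auto simp: S_def)
qed

text \<open>Extending \<open>f\<close> from \<open>D\<close> to the whole line gives a function with
  the property that can differ from \<open>f\<close> only on \<open>dom f - D\<close>. The
  restoration is arbitrary at erased points, as only nonerased points count for the
  distance.\<close>

lemma erasure_far_violations:
  assumes far: "erasure_far {g. has_bounded_derivative l u {1..n} g} \<epsilon> f"
    and lu: "\<And>t. t \<in> {1..n - 1} \<Longrightarrow> l t < u t" and f: "dom f \<subseteq> {1..n}"
    and D: "D \<subseteq> dom f" "has_bounded_derivative l u D (\<lambda>x. the (f x))"
  shows "\<epsilon> * real (card (dom f)) \<le> real (card (dom f - D))"
proof -
  obtain h where h: "has_bounded_derivative l u {1..n} h" "\<And>x. x \<in> D \<Longrightarrow> h x = the (f x)"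
    using has_bounded_derivative_extend[OF lu _ D(2), of n] D f by blast
  have "restoration f (\<lambda>x. the (f x))"
    by (auto simp: restoration_def)
  then have "\<epsilon> * real (card (dom f)) \<le> real (card {x\<in>dom f. the (f x) \<noteq> h x})"
    using far h(1) unfolding erasure_far_def by blast
  also have "card {x\<in>dom f. the (f x) \<noteq> h x} \<le> card (dom f - D)"
    using h(2) f by (intro card_mono) (auto intro: finite_subset)
  finally show ?thesis by simp
qed

section \<open>Counting random choices\<close>

text \<open>The whole sample space of the tester, used with the uniform distribution: a permutation
  and \<open>t\<close> draws with repetition. Probabilities become ratios of cardinalities.\<close>

definition choices :: "nat \<Rightarrow> nat \<Rightarrow> (nat list \<times> nat list) set" where
  "choices n t = permutations_of_set {1..n} \<times> {xs. set xs \<subseteq> {1..n} \<and> length xs = t}"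

lemma finite_choices [simp]: "finite (choices n t)"
  by (simp add: choices_def finite_lists_length_eq)

lemma card_choices: "card (choices n t) = fact n * n ^ t"
  by (simp add: choices_def card_cartesian_product card_lists_length_eq)

lemma choices_nonempty: "n \<ge> 1 \<Longrightarrow> choices n t \<noteq> {}"
  using card_choices[of n t] by auto

text \<open>Linearity of expectation: each of the \<open>t\<close> positions contributes the mean of
  \<open>g\<close>. The factor \<open>card A\<close> on the left avoids the exponent
  \<open>t - 1\<close>.\<close>

lemma sum_lists_length:
  fixes g :: "'a \<Rightarrow> real"
  assumes "finite A"
  shows "real (card A) * (\<Sum>xs\<in>{xs. set xs \<subseteq> A \<and> length xs = t}. \<Sum>x\<leftarrow>xs. g x)
           = real t * real (card A) ^ t * (\<Sum>x\<in>A. g x)"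
proof (induction t)
  case 0
  have "{xs::'a list. set xs \<subseteq> A \<and> length xs = 0} = {[]}" by auto
  then show ?case by simp
next
  case (Suc t)
  let ?L = "\<lambda>t. {xs. set xs \<subseteq> A \<and> length xs = t}"
  have "(\<Sum>xs\<in>?L (Suc t). \<Sum>x\<leftarrow>xs. g x) = (\<Sum>(xs, x)\<in>?L t \<times> A. g x + (\<Sum>y\<leftarrow>xs. g y))"
    unfolding lists_length_Suc_eq
    by (subst sum.reindex) (auto simp: inj_on_def intro!: sum.cong)
  also have "\<dots> = (\<Sum>xs\<in>?L t. \<Sum>x\<in>A. g x + (\<Sum>y\<leftarrow>xs. g y))"
    by (simp add: sum.cartesian_product)
  also have "\<dots> = real (card A) ^ t * (\<Sum>x\<in>A. g x) + real (card A) * (\<Sum>xs\<in>?L t. \<Sum>x\<leftarrow>xs. g x)"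
    using assms by (simp add: sum.distrib card_lists_length_eq sum_distrib_left)
  finally show ?case
    using Suc by (simp add: algebra_simps)
qed

section \<open>Two failure events of probability at most 1/6\<close>

definition cost :: "nat set \<Rightarrow> nat list \<times> nat list \<Rightarrow> nat" where
  "cost N = (\<lambda>(\<pi>, xs). \<Sum>x\<leftarrow>xs. 1 + search_cost N \<pi> x)"

lemma sum_cost:
  assumes "N \<subseteq> {1..n}" "n \<ge> 1"
  shows "(\<Sum>\<omega>\<in>choices n t. real (cost N \<omega>)) \<le> real (card (choices n t)) * (real t * (1 + 2 * harm n))"
proof -
  let ?L = "{xs. set xs \<subseteq> {1..n} \<and> length xs = t}"
  have cost: "real (cost N (\<pi>, xs)) = (\<Sum>x\<leftarrow>xs. 1 + real (search_cost N \<pi> x))" for \<pi> xs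
    by (induction xs) (auto simp: cost_def)
  have "real n * (\<Sum>\<omega>\<in>choices n t. real (cost N \<omega>))
      = (\<Sum>\<pi>\<in>permutations_of_set {1..n}. real n * (\<Sum>xs\<in>?L. \<Sum>x\<leftarrow>xs. 1 + real (search_cost N \<pi> x)))"
    by (simp add: choices_def sum.cartesian_product' cost sum_distrib_left)
  also have "\<dots> = (\<Sum>\<pi>\<in>permutations_of_set {1..n}. real t * real n ^ t * (\<Sum>x=1..n. 1 + real (search_cost N \<pi> x)))"
    using sum_lists_length[where A = "{1..n}" and t = t] by (intro sum.cong refl) simp
  also have "\<dots> = real t * real n ^ t *
      (fact n * real n + (\<Sum>\<pi>\<in>permutations_of_set {1..n}. \<Sum>x=1..n. real (search_cost N \<pi> x)))"
    by (simp add: sum_distrib_left[symmetric] sum.distrib)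
  also have "\<dots> \<le> real t * real n ^ t * (fact n * real n + fact n * (2 * harm n) * real n)"
    by (intro mult_left_mono add_left_mono sum_search_cost assms) auto
  also have "\<dots> = real n * (real (card (choices n t)) * (real t * (1 + 2 * harm n)))"
    by (simp add: card_choices algebra_simps)
  finally show ?thesis using assms by simp
qed

text \<open>Markov's inequality. An integer cost above \<open>q\<close> is at least
  \<open>q + 1\<close>, so it suffices that \<open>q + 1\<close> is six times the bound on the mean,
  which later permits \<open>q\<close> to be rounded down.\<close>

lemma card_cost_gt:
  assumes "N \<subseteq> {1..n}" "n \<ge> 1" and q: "6 * (real t * (1 + 2 * harm n)) \<le> real q + 1"
  shows "6 * real (card {\<omega>\<in>choices n t. q < cost N \<omega>}) \<le> real (card (choices n t))"
proof -
  let ?M = "{\<omega>\<in>choices n t. q < cost N \<omega>}"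
  have "(real q + 1) * real (card ?M) = (\<Sum>\<omega>\<in>?M. real q + 1)"
    by simp
  also have "\<dots> \<le> (\<Sum>\<omega>\<in>?M. real (cost N \<omega>))"
    by (intro sum_mono) auto
  also have "\<dots> \<le> (\<Sum>\<omega>\<in>choices n t. real (cost N \<omega>))"
    by (intro sum_mono2) auto
  also have "\<dots> \<le> real (card (choices n t)) * (real t * (1 + 2 * harm n))"
    by (intro sum_cost assms)
  also have "\<dots> \<le> real (card (choices n t)) * ((real q + 1) / 6)"
    using q by (intro mult_left_mono) auto
  finally have "(real q + 1) * (6 * real (card ?M)) \<le> (real q + 1) * real (card (choices n t))"
    by (simp add: algebra_simps)
  then show ?thesis
    by (rule mult_left_le_imp_le) auto
qed

text \<open>Multiply by \<open>(1 + \<delta>) ^ t\<close>, which is at least 6 by Bernoulli's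
  inequality; the product \<open>(1 - \<delta>\<^sup>2) ^ t\<close> is at most 1.\<close>

lemma one_minus_power_le:
  fixes \<delta> :: real
  assumes "0 < \<delta>" "\<delta> \<le> 1" "5 \<le> real t * \<delta>"
  shows "(1 - \<delta>) ^ t \<le> 1 / 6"
proof -
  have "6 * (1 - \<delta>) ^ t \<le> (1 + \<delta>) ^ t * (1 - \<delta>) ^ t"
    using Bernoulli_inequality[of \<delta> t] assms by (intro mult_right_mono) auto
  also have "\<dots> = (1 - \<delta>\<^sup>2) ^ t"
    by (simp add: power_mult_distrib[symmetric] algebra_simps power2_eq_square)
  also have "\<dots> \<le> 1"
    using assms by (intro power_le_one) (auto simp: power_le_one)
  finally show ?thesis by simp
qed

lemma card_choices_avoiding:
  assumes B: "\<And>\<pi>. \<pi> \<in> permutations_of_set {1..n} \<Longrightarrow> B \<pi> \<subseteq> {1..n} \<and> \<delta> * real n \<le> real (card (B \<pi>))"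
    and "0 < \<delta>" "\<delta> \<le> 1" "5 \<le> real t * \<delta>"
  shows "6 * real (card {(\<pi>, xs)\<in>choices n t. set xs \<inter> B \<pi> = {}}) \<le> real (card (choices n t))"
proof -
  let ?L = "\<lambda>\<pi>. {xs. set xs \<subseteq> {1..n} - B \<pi> \<and> length xs = t}"
  have "{(\<pi>, xs)\<in>choices n t. set xs \<inter> B \<pi> = {}} = Sigma (permutations_of_set {1..n}) ?L"
    by (auto simp: choices_def)
  then have "real (card {(\<pi>, xs)\<in>choices n t. set xs \<inter> B \<pi> = {}})
      = (\<Sum>\<pi>\<in>permutations_of_set {1..n}. real (card (?L \<pi>)))"
    by (simp add: finite_lists_length_eq)
  also have "\<dots> \<le> (\<Sum>\<pi>\<in>permutations_of_set {1..n}. real n ^ t / 6)"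
  proof (rule sum_mono)
    fix \<pi> assume \<pi>: "\<pi> \<in> permutations_of_set {1..n}"
    have "B \<pi> \<subseteq> {1..n}" using B[OF \<pi>] by blast
    then have "real (card ({1..n} - B \<pi>)) = real n - real (card (B \<pi>))"
      using card_mono[of "{1..n}" "B \<pi>"]
      by (simp add: card_Diff_subset finite_subset[of "B \<pi>"] of_nat_diff)
    also have "\<dots> \<le> (1 - \<delta>) * real n"
      using B[OF \<pi>] by (simp add: algebra_simps)
    finally have "real (card ({1..n} - B \<pi>)) ^ t \<le> ((1 - \<delta>) * real n) ^ t"
      by (intro power_mono) auto
    also have "\<dots> = (1 - \<delta>) ^ t * real n ^ t"
      by (simp add: power_mult_distrib)
    also have "\<dots> \<le> 1 / 6 * real n ^ t"
      using assms by (intro mult_right_mono one_minus_power_le) auto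
    finally show "real (card (?L \<pi>)) \<le> real n ^ t / 6"
      by (simp add: card_lists_length_eq)
  qed
  also have "\<dots> = real (card (choices n t)) / 6"
    by (simp add: card_choices)
  finally show ?thesis by simp
qed

section \<open>The tester\<close>

definition line_tester ::
    "(nat \<Rightarrow> real \<Rightarrow> nat \<Rightarrow> real \<Rightarrow> bool) \<Rightarrow> nat \<Rightarrow> nat \<Rightarrow> nat \<Rightarrow> query_algorithm" where
  "line_tester V n t q =
     Sample (map_pmf (\<lambda>(\<pi>, xs). truncate_queries (test_points V \<pi> xs) q) (pmf_of_set (choices n t)))"

lemma run_line_tester:
  "run f (line_tester V n t q) =
     map_pmf (\<lambda>(\<pi>, xs). play f (truncate_queries (test_points V \<pi> xs) q)) (pmf_of_set (choices n t))"
  by (simp add: line_tester_def case_prod_unfold bind_map_pmf run_deterministic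
      deterministic_truncate deterministic_test_points flip: bind_eq_join_pmf)
    (simp add: map_pmf_def)

lemma set_run_line_tester:
  assumes "n \<ge> 1" "(b, qs) \<in> set_pmf (run f (line_tester V n t q))"
  obtains \<pi> xs where "(\<pi>, xs) \<in> choices n t" "(b, qs) = play f (truncate_queries (test_points V \<pi> xs) q)"
  using assms choices_nonempty[of n t] by (auto simp: run_line_tester set_pmf_of_set)

lemma line_tester_queries:
  assumes "n \<ge> 1" "(b, qs) \<in> set_pmf (run f (line_tester V n t q))"
  shows "set qs \<subseteq> {1..n}" "length qs \<le> q"
proof -
  obtain \<pi> xs where \<omega>: "(\<pi>, xs) \<in> choices n t"
    "(b, qs) = play f (truncate_queries (test_points V \<pi> xs) q)"
    using assms by (rule set_run_line_tester)
  have qs: "qs = snd (play f (truncate_queries (test_points V \<pi> xs) q))"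
    by (simp flip: \<omega>(2))
  have "set qs \<subseteq> set (snd (play f (test_points V \<pi> xs)))"
    unfolding qs by (rule set_play_truncate[OF deterministic_test_points])
  also have "\<dots> \<subseteq> {1..n}"
    using set_play_test_points[of f V \<pi> xs] \<omega>(1) by (auto simp: choices_def permutations_of_set_def)
  finally show "set qs \<subseteq> {1..n}" .
  show "length qs \<le> q"
    unfolding qs by (rule length_play_truncate[OF deterministic_test_points])
qed

lemma line_tester_accepts:
  assumes "n \<ge> 1" "(b, qs) \<in> set_pmf (run f (line_tester V n t q))"
    and "\<And>x v z w. f x = Some v \<Longrightarrow> f z = Some w \<Longrightarrow> V x v z w"
  shows b
proof -
  obtain \<pi> xs where \<omega>: "(\<pi>, xs) \<in> choices n t"
    "(b, qs) = play f (truncate_queries (test_points V \<pi> xs) q)"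
    using assms(1,2) by (rule set_run_line_tester)
  have "fst (play f (truncate_queries (test_points V \<pi> xs) q))"
    by (intro play_truncate_accept deterministic_test_points test_points_accept assms(3))
  then show b by (simp flip: \<omega>(2))
qed

section \<open>The tester for bounded derivative properties\<close>

definition pair_consistent ::
    "(nat \<Rightarrow> ereal) \<Rightarrow> (nat \<Rightarrow> ereal) \<Rightarrow> nat \<Rightarrow> real \<Rightarrow> nat \<Rightarrow> real \<Rightarrow> bool" where
  "pair_consistent l u x v z w \<longleftrightarrow> has_bounded_derivative l u {x, z} ((\<lambda>_. w)(x := v))"

text \<open>Only the values at \<open>x\<close> and \<open>z\<close> matter, which is all that two
  queries reveal. As \<open>{x, z}\<close> is unordered, one check serves for \<open>z\<close> on
  either side of \<open>x\<close>.\<close>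

lemma pair_consistent_iff:
  assumes "g x = v" "g z = w"
  shows "pair_consistent l u x v z w \<longleftrightarrow> has_bounded_derivative l u {x, z} g"
  unfolding pair_consistent_def using assms by (intro has_bounded_derivative_cong) auto

text \<open>The bad event \<open>E\<close> is that the cost exceeds \<open>q\<close> or that no
  drawn point lies in \<open>N - D \<pi>\<close>. Each alternative has probability at most 1/6.
  Outside \<open>E\<close> the run is not cut off and some search meets a violation.\<close>

lemma line_tester_rejects:
  assumes n: "n \<ge> 1" and lu: "\<And>t. t \<in> {1..n - 1} \<Longrightarrow> l t < u t"
    and f: "erased_function n \<alpha> f" and far: "erasure_far {g. has_bounded_derivative l u {1..n} g} \<epsilon> f"
    and \<alpha>: "0 < \<alpha>" "\<alpha> < 1" and \<epsilon>: "0 < \<epsilon>" "\<epsilon> < 1" and t: "5 \<le> real t * (\<epsilon> * (1 - \<alpha>))"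
    and q: "6 * (real t * (1 + 2 * harm n)) \<le> real q + 1"
  shows "measure_pmf.prob (run f (line_tester (pair_consistent l u) n t q)) {(b, qs). \<not> b} \<ge> 2 / 3"
proof -
  define N where "N = dom f"
  define g where "g x = the (f x)" for x
  \<comment> \<open>The points whose search along \<open>\<pi>\<close> finds no violation. The
    property holds on this set for every \<open>\<pi>\<close>, so its complement in \<open>N\<close>
    is always large.\<close>
  define D where "D \<pi> = {x\<in>N. \<forall>z\<in>N. visits N \<pi> x z \<longrightarrow> has_bounded_derivative l u {x, z} g}" for \<pi>
  define E where "E = {\<omega>\<in>choices n t. q < cost N \<omega>} \<union> {(\<pi>, xs)\<in>choices n t. set xs \<inter> (N - D \<pi>) = {}}"
  define A where "A = (\<lambda>(\<pi>, xs). play f (truncate_queries (test_points (pair_consistent l u) \<pi> xs) q))"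
  have N: "N \<subseteq> {1..n}" using f by (simp add: erased_function_def N_def)
  have cardN: "(1 - \<alpha>) * real n \<le> real (card N)"
  proof -
    have "real (card ({1..n} - N)) = real n - real (card N)"
      using N card_mono[of "{1..n}" N] by (simp add: card_Diff_subset finite_subset[of N] of_nat_diff)
    then show ?thesis using f by (simp add: erased_function_def N_def algebra_simps)
  qed
  have violations: "N - D \<pi> \<subseteq> {1..n} \<and> \<epsilon> * (1 - \<alpha>) * real n \<le> real (card (N - D \<pi>))"
    if "\<pi> \<in> permutations_of_set {1..n}" for \<pi>
  proof -
    have "has_bounded_derivative l u (D \<pi>) g"
      by (rule has_bounded_derivative_visited[OF _ D_def])
        (use N that in \<open>auto simp: permutations_of_set_def\<close>)
    then have "\<epsilon> * real (card N) \<le> real (card (N - D \<pi>))"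
      unfolding N_def g_def using far lu N
      by (intro erasure_far_violations) (auto simp: D_def N_def)
    moreover have "\<epsilon> * ((1 - \<alpha>) * real n) \<le> \<epsilon> * real (card N)"
      using cardN \<epsilon> by (intro mult_left_mono) auto
    ultimately show ?thesis using N by (auto simp: mult.assoc)
  qed
  have "real (card E) \<le> real (card {\<omega>\<in>choices n t. q < cost N \<omega>})
      + real (card {(\<pi>, xs)\<in>choices n t. set xs \<inter> (N - D \<pi>) = {}})"
    unfolding E_def of_nat_add[symmetric] of_nat_le_iff by (rule card_Un_le)
  moreover have "\<epsilon> * (1 - \<alpha>) \<le> 1"
    using \<alpha> \<epsilon> by (intro mult_le_one) auto
  ultimately have cardE: "3 * real (card E) \<le> real (card (choices n t))"
    using card_cost_gt[OF N n q] \<alpha> \<epsilon> t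
      card_choices_avoiding[of n "\<lambda>\<pi>. N - D \<pi>" "\<epsilon> * (1 - \<alpha>)" t, OF violations]
    by auto
  have reject: "\<not> fst (A \<omega>)" if "\<omega> \<in> choices n t - E" for \<omega>
  proof
    assume accept: "fst (A \<omega>)"
    obtain \<pi> xs where \<omega>: "\<omega> = (\<pi>, xs)" by (cases \<omega>)
    have \<pi>: "distinct \<pi>" "set \<pi> = {1..n}"
      using that by (auto simp: \<omega> choices_def permutations_of_set_def)
    have "set xs \<inter> (N - D \<pi>) \<noteq> {}"
      using that unfolding \<omega> E_def by blast
    then obtain x where x: "x \<in> set xs" "x \<in> N" "x \<notin> D \<pi>"
      by blast
    then obtain z where z: "z \<in> N" "visits N \<pi> x z" "\<not> has_bounded_derivative l u {x, z} g"
      by (auto simp: D_def)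
    have "length (snd (play f (test_points (pair_consistent l u) \<pi> xs))) \<le> cost N \<omega>"
      using length_play_test_points[OF \<pi>(1), of f "pair_consistent l u" xs] by (simp add: \<omega> cost_def N_def)
    also have "\<dots> \<le> q" using that by (auto simp: E_def)
    finally have "fst (play f (test_points (pair_consistent l u) \<pi> xs))"
      using accept by (simp add: A_def \<omega> play_truncate_eq deterministic_test_points)
    from test_points_accept_imp[OF this \<pi>(1) x(1), of "g x" z "g z"] x z N \<pi>
    have "pair_consistent l u x (g x) z (g z)"
      by (auto simp: N_def g_def)
    then show False using z by (simp add: pair_consistent_iff[of g])
  qed
  have "real (card (choices n t)) > 0"
    using choices_nonempty[OF n] by (simp add: card_gt_0_iff)
  moreover have "card (choices n t - E) = card (choices n t) - card E"
    by (rule card_Diff_subset) (auto simp: E_def intro: finite_subset[OF _ finite_choices[of n t]])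
  moreover have "card E \<le> card (choices n t)"
    by (rule card_mono) (auto simp: E_def)
  ultimately have "2 / 3 \<le> real (card (choices n t - E)) / real (card (choices n t))"
    using cardE by (simp add: of_nat_diff field_simps)
  also have "\<dots> \<le> real (card (choices n t \<inter> A -` {(b, qs). \<not> b})) / real (card (choices n t))"
    using reject by (intro divide_right_mono of_nat_mono card_mono) (auto simp: case_prod_unfold)
  also have "\<dots> = measure_pmf.prob (run f (line_tester (pair_consistent l u) n t q)) {(b, qs). \<not> b}"
    using choices_nonempty[OF n] by (simp add: run_line_tester A_def measure_pmf_of_set)
  finally show ?thesis .
qed

lemma line_tester_properties:
  assumes n: "n \<ge> 1" and lu: "\<And>t. t \<in> {1..n - 1} \<Longrightarrow> l t < u t"
    and \<alpha>: "0 < \<alpha>" "\<alpha> < 1" and \<epsilon>: "0 < \<epsilon>" "\<epsilon> < 1" and t: "5 \<le> real t * (\<epsilon> * (1 - \<alpha>))"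
    and q: "6 * (real t * (1 + 2 * harm n)) \<le> real q + 1"
  defines "P \<equiv> {g. has_bounded_derivative l u {1..n} g}"
    and "T \<equiv> line_tester (pair_consistent l u) n t q"
  shows "erasure_resilient_tester n P \<alpha> \<epsilon> T \<and> one_sided_error n P \<alpha> T \<and> query_complexity_le n \<alpha> T (real q)"
proof -
  have accept: b if f: "erased_function n \<alpha> f" "restorable P f" and b: "(b, qs) \<in> set_pmf (run f T)" for f b qs
  proof (rule line_tester_accepts[OF n b[unfolded T_def]])
    fix x v z w assume xz: "f x = Some v" "f z = Some w"
    obtain g where g: "restoration f g" "has_bounded_derivative l u {1..n} g"
      using f(2) by (auto simp: restorable_def P_def)
    have "x \<in> {1..n}" "z \<in> {1..n}"
      using xz f(1) by (auto simp: erased_function_def)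
    then have "has_bounded_derivative l u {x, z} g"
      using g(2) by (auto simp: has_bounded_derivative_def)
    moreover have "g x = v" "g z = w"
      using g(1) xz by (auto simp: restoration_def dom_def)
    ultimately show "pair_consistent l u x v z w"
      by (simp add: pair_consistent_iff)
  qed
  have "measure_pmf.prob (run f T) {(b, qs). b} \<ge> 2 / 3"
    if "erased_function n \<alpha> f" "restorable P f" for f
  proof -
    have "measure_pmf.prob (run f T) {(b, qs). b} = 1"
      using accept[OF that] by (subst measure_pmf.prob_eq_1) (auto intro!: AE_pmfI)
    then show ?thesis by simp
  qed
  moreover have "measure_pmf.prob (run f T) {(b, qs). \<not> b} \<ge> 2 / 3"
    if "erased_function n \<alpha> f" "erasure_far P \<epsilon> f" for f
    using that unfolding P_def T_def by (intro line_tester_rejects[OF n lu _ _ \<alpha> \<epsilon> t q])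
  ultimately show ?thesis
    using accept line_tester_queries[OF n, of _ _ _ "pair_consistent l u" t q]
    unfolding erasure_resilient_tester_def one_sided_error_def query_complexity_le_def T_def
    by (fastforce simp: split_beta)
qed

text \<open>On one point the property is vacuous, and \<open>\<alpha> < 1\<close> keeps that point
  nonerased, so nothing is far. This case is separate because \<open>log 2 1 = 0\<close> permits no
  query at all.\<close>

lemma not_erasure_far_one:
  assumes f: "erased_function 1 \<alpha> f" and "\<alpha> < 1" "0 < \<epsilon>"
  shows "\<not> erasure_far {g. has_bounded_derivative l u {1..1} g} \<epsilon> f"
proof
  assume far: "erasure_far {g. has_bounded_derivative l u {1..1} g} \<epsilon> f"
  have "restoration f (\<lambda>x. the (f x))"
    by (auto simp: restoration_def)
  moreover have "(\<lambda>x. the (f x)) \<in> {g. has_bounded_derivative l u {1..1} g}"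
    by (auto simp: has_bounded_derivative_def)
  ultimately have "\<epsilon> * real (card (dom f)) \<le> real (card {x\<in>dom f. the (f x) \<noteq> the (f x)})"
    by (rule far[unfolded erasure_far_def, rule_format])
  then have "card (dom f) = 0"
    using \<open>0 < \<epsilon>\<close> by (simp add: mult_le_0_iff)
  moreover have "finite (dom f)"
    using f finite_subset by (auto simp: erased_function_def)
  ultimately show False
    using f \<open>\<alpha> < 1\<close> by (simp add: erased_function_def)
qed

theorem theorem5p5:
  "\<exists>C>0. \<forall>n\<ge>1. \<forall>P. bounded_derivative_property n P \<longrightarrow>
     (\<exists>T :: real \<Rightarrow> real \<Rightarrow> query_algorithm.
        \<forall>\<alpha>\<in>{0<..<1}. \<forall>\<epsilon>\<in>{0<..<1}.
          erasure_resilient_tester n P \<alpha> \<epsilon> (T \<alpha> \<epsilon>) \<and>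
          one_sided_error n P \<alpha> (T \<alpha> \<epsilon>) \<and>
          query_complexity_le n \<alpha> (T \<alpha> \<epsilon>) (C * (1 / (1 - \<alpha>) * (log 2 (real n) / \<epsilon>))))"
\<comment> \<open>The constant is 6 * 5 * 6: the factor 6 from Markov's inequality,
  \<open>1 + 2 * harm n \<le> 5 * log 2 n\<close>, and at most \<open>6 / \<delta>\<close> drawn
  points.\<close>
proof (intro exI[of _ "180 :: real"] conjI allI impI)
  fix n :: nat and P assume n: "n \<ge> 1" and "bounded_derivative_property n P"
  then obtain l u where "\<forall>t\<in>{1..n - 1}. l t < u t"
    and P: "P = {g. has_bounded_derivative l u {1..n} g}"
    unfolding bounded_derivative_property_def by blast
  then have lu: "l t < u t" if "t \<in> {1..n - 1}" for t
    using that by blast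
  show "\<exists>T :: real \<Rightarrow> real \<Rightarrow> query_algorithm.
        \<forall>\<alpha>\<in>{0<..<1}. \<forall>\<epsilon>\<in>{0<..<1}.
          erasure_resilient_tester n P \<alpha> \<epsilon> (T \<alpha> \<epsilon>) \<and>
          one_sided_error n P \<alpha> (T \<alpha> \<epsilon>) \<and>
          query_complexity_le n \<alpha> (T \<alpha> \<epsilon>) (180 * (1 / (1 - \<alpha>) * (log 2 (real n) / \<epsilon>)))"
  proof (cases "n = 1")
    case True
    show ?thesis
      using not_erasure_far_one[of _ _ _ l u]
      by (intro exI[of _ "\<lambda>_ _. Verdict True"])
        (auto simp: True P erasure_resilient_tester_def one_sided_error_def query_complexity_le_def
          measure_return_pmf)
  next
    case False
    define \<delta> where "\<delta> \<alpha> \<epsilon> = \<epsilon> * (1 - \<alpha>)" for \<alpha> \<epsilon> :: real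
    \<comment> \<open>Bernoulli's inequality asks for \<open>t * \<delta> \<ge> 5\<close>; rounding
      up adds at most 1, which is at most \<open>1 / \<delta>\<close>.\<close>
    define t where "t \<alpha> \<epsilon> = nat \<lceil>5 / \<delta> \<alpha> \<epsilon>\<rceil>" for \<alpha> \<epsilon>
    define q where "q \<alpha> \<epsilon> = nat \<lfloor>30 * real (t \<alpha> \<epsilon>) * log 2 (real n)\<rfloor>" for \<alpha> \<epsilon>
    have log: "1 \<le> log 2 (real n)"
      using n False by (subst le_log_iff) auto
    have ln_le: "ln (real n) \<le> log 2 (real n)"
    proof -
      have "ln (2 :: real) \<le> 1" using ln_le_minus_one[of 2] by simp
      then have "ln (real n) / 1 \<le> ln (real n) / ln 2"
        using n by (intro divide_left_mono) auto
      then show ?thesis by (simp add: log_def)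
    qed
    \<comment> \<open>Since \<open>harm n - ln n\<close> decreases from 1, the left side is at most
      \<open>3 + 2 * ln n\<close>. For \<open>n \<ge> 2\<close> the constant 3 is absorbed by three
      copies of the logarithm.\<close>
    have harm: "1 + 2 * harm n \<le> 5 * log 2 (real n)"
    proof -
      have "harm n - ln (real n) \<le> harm 1 - ln (real 1)"
        using n by (intro euler_mascheroni_sequence_decreasing) auto
      then show ?thesis using log ln_le by (simp add: harm_expand)
    qed
    show ?thesis
    proof (intro exI[of _ "\<lambda>\<alpha> \<epsilon>. line_tester (pair_consistent l u) n (t \<alpha> \<epsilon>) (q \<alpha> \<epsilon>)"] ballI)
      fix \<alpha> \<epsilon> :: real assume "\<alpha> \<in> {0<..<1}" "\<epsilon> \<in> {0<..<1}"
      then have \<alpha>: "0 < \<alpha>" "\<alpha> < 1" and \<epsilon>: "0 < \<epsilon>" "\<epsilon> < 1" by auto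
      have \<delta>: "0 < \<delta> \<alpha> \<epsilon>" "\<delta> \<alpha> \<epsilon> \<le> 1"
        using \<alpha> \<epsilon> by (auto simp: \<delta>_def intro!: mult_le_one)
      have t: "5 / \<delta> \<alpha> \<epsilon> \<le> real (t \<alpha> \<epsilon>)" "real (t \<alpha> \<epsilon>) \<le> 6 / \<delta> \<alpha> \<epsilon>"
      proof -
        show "5 / \<delta> \<alpha> \<epsilon> \<le> real (t \<alpha> \<epsilon>)"
          unfolding t_def by (rule real_nat_ceiling_ge)
        have "0 \<le> \<lceil>5 / \<delta> \<alpha> \<epsilon>\<rceil>"
          using \<delta> by (intro order_less_imp_le) (simp add: less_ceiling_iff)
        then have "real (t \<alpha> \<epsilon>) \<le> 5 / \<delta> \<alpha> \<epsilon> + 1"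
          using of_int_ceiling_le_add_one[of "5 / \<delta> \<alpha> \<epsilon>"] by (simp add: t_def)
        also have "\<dots> \<le> 6 / \<delta> \<alpha> \<epsilon>" using \<delta> by (simp add: field_simps)
        finally show "real (t \<alpha> \<epsilon>) \<le> 6 / \<delta> \<alpha> \<epsilon>" .
      qed
      have q: "real (q \<alpha> \<epsilon>) \<le> 30 * real (t \<alpha> \<epsilon>) * log 2 (real n)"
        "30 * real (t \<alpha> \<epsilon>) * log 2 (real n) \<le> real (q \<alpha> \<epsilon>) + 1"
        using log unfolding q_def by (simp_all add: of_nat_nat)
      have "6 * (real (t \<alpha> \<epsilon>) * (1 + 2 * harm n)) \<le> 6 * (real (t \<alpha> \<epsilon>) * (5 * log 2 (real n)))"
        by (intro mult_left_mono harm) auto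
      also have "\<dots> \<le> real (q \<alpha> \<epsilon>) + 1" using q(2) by simp
      finally have props: "erasure_resilient_tester n P \<alpha> \<epsilon> T \<and> one_sided_error n P \<alpha> T \<and>
          query_complexity_le n \<alpha> T (real (q \<alpha> \<epsilon>))"
        if "T = line_tester (pair_consistent l u) n (t \<alpha> \<epsilon>) (q \<alpha> \<epsilon>)" for T
        unfolding P that using \<delta> t(1) n lu \<alpha> \<epsilon>
        by (intro line_tester_properties) (auto simp: field_simps \<delta>_def[symmetric])
      have "real (q \<alpha> \<epsilon>) \<le> 30 * (6 / \<delta> \<alpha> \<epsilon>) * log 2 (real n)"
        using q(1) mult_right_mono[of "30 * real (t \<alpha> \<epsilon>)" "30 * (6 / \<delta> \<alpha> \<epsilon>)" "log 2 (real n)"] t(2) log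
        by linarith
      also have "\<dots> = 180 * (1 / (1 - \<alpha>) * (log 2 (real n) / \<epsilon>))"
        by (simp add: \<delta>_def)
      finally show "erasure_resilient_tester n P \<alpha> \<epsilon> (line_tester (pair_consistent l u) n (t \<alpha> \<epsilon>) (q \<alpha> \<epsilon>)) \<and>
          one_sided_error n P \<alpha> (line_tester (pair_consistent l u) n (t \<alpha> \<epsilon>) (q \<alpha> \<epsilon>)) \<and>
          query_complexity_le n \<alpha> (line_tester (pair_consistent l u) n (t \<alpha> \<epsilon>) (q \<alpha> \<epsilon>))
            (180 * (1 / (1 - \<alpha>) * (log 2 (real n) / \<epsilon>)))"
        using props[OF refl] unfolding query_complexity_le_def by (fastforce intro: order_trans)
    qed
  qed
qed simp

end
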